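(* (Ogden model.) Let $\lambda,\mu,\rho_0>0$ and, for $\Gamma>-1$, let $$P(\Gamma)=\frac1{\rho_0}\Big(\lambda\Gamma+\mu\frac{(2+\Gamma)\Gamma}{\Gamma+1}\Big).$$ Then: (a) $P'(\Gamma)>0$ (hyperbolicity) for all $\Gamma>-1$; (b) $P''(\Gamma)<0$ (genuine nonlinearity) for all $\Gamma>-1$; (c) for all $\Gamma_l\in(-1,0]$ (i.e. $s=1+\Gamma_l\in(0,1]$), $S(\Gamma_l)$ satisfies the entropy condition for the standard entropy function, i.e. $2\int_0^{\Gamma_l}P(w)\,dw\le\Gamma_lP(\Gamma_l)$.
   Context: The p-system is $V_t-(P(\Gamma))_X=0$, $\Gamma_t-V_X=0$, with $\Gamma>-1$. The compression shock $S(\Gamma_l)$, $\Gamma_l<0$, is $(V,\Gamma)=(-V_0,0)$ for $X>\sigma t$, $(V,\Gamma)=(0,\Gamma_l)$ for $X<\sigma t$, with $V_0=\sqrt{\Gamma_lP(\Gamma_l)}$, $\sigma=-V_0/\Gamma_l$; $S(0)=(0,0)$. The standard entropy/entropy-flux pair is $\Phi(V,\Gamma)=\frac{V^2}{2}+\int_0^\Gamma P(w)\,dw$, $\Psi(V,\Gamma)=-P(\Gamma)V$; for $S(\Gamma_l)$ the corresponding entropy condition is by definition the inequality $2\int_0^{\Gamma_l}P(w)\,dw\le\Gamma_lP(\Gamma_l)$. *)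

theory Defs
  imports "HOL-Analysis.Analysis"
begin

definition ogden_P :: "real \<Rightarrow> real \<Rightarrow> real \<Rightarrow> real \<Rightarrow> real" where
  "ogden_P lam mu rho0 \<Gamma> =
     (1 / rho0) * (lam * \<Gamma> + mu * ((2 + \<Gamma>) * \<Gamma> / (\<Gamma> + 1)))"

(* The entropy condition for the compression shock S(Gl) of the p-system with stress P, with
   respect to the standard entropy pair
     Phi(V,G) = V^2/2 + int_0^G P(w) dw,   Psi(V,G) = - P(G) V.
   The integral is oriented: for Gl < 0 it is minus the integral over {Gl..0}. *)
definition std_entropy_condition :: "(real \<Rightarrow> real) \<Rightarrow> real \<Rightarrow> bool" where
  "std_entropy_condition P \<Gamma>\<^sub>l \<longleftrightarrow>
     2 * (LBINT w=ereal 0..ereal \<Gamma>\<^sub>l. P w) \<le> \<Gamma>\<^sub>l * P \<Gamma>\<^sub>l"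

end

(* With s = 1 + G the stress is P = (lam * G + mu * (s - 1/s)) / rho0. Its explicit primitive
   reduces the entropy condition to 1/s - s + 2 * ln s >= 0 on (0,1]; the left-hand side vanishes
   at s = 1 and has derivative -(1 - 1/s)^2. *)
theory Submission
  imports Defs
begin

text \<open>Since (2 + \<Gamma>) * \<Gamma> = (\<Gamma> + 1)^2 - 1, the quotient splits into a
  linear and a reciprocal term, each easy to differentiate and to integrate.\<close>

lemma ogden_P_alt:
  assumes "\<Gamma> > -1"
  shows "ogden_P lam mu rho0 \<Gamma> = (lam * \<Gamma> + mu * ((\<Gamma> + 1) - 1 / (\<Gamma> + 1))) / rho0"
proof -
  have "(2 + \<Gamma>) * \<Gamma> / (\<Gamma> + 1) = (\<Gamma> + 1) - 1 / (\<Gamma> + 1)"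
    using assms by (simp add: field_simps)
  then show ?thesis
    by (simp add: ogden_P_def)
qed

lemma ogden_P_has_derivative:
  assumes "\<Gamma> > -1"
  shows "(ogden_P lam mu rho0 has_real_derivative
           (lam + mu * (1 + 1 / (\<Gamma> + 1)\<^sup>2)) / rho0) (at \<Gamma>)"
\<comment> \<open>A derivative depends only on values nearby, and \<open>ogden_P_alt\<close> applies
  on the open set \<open>{-1<..}\<close>.\<close>
proof (rule DERIV_cong_ev[THEN iffD1, OF refl _ refl])
  show "\<forall>\<^sub>F x in nhds \<Gamma>. (lam * x + mu * ((x + 1) - 1 / (x + 1))) / rho0 = ogden_P lam mu rho0 x"
    using eventually_nhds_in_open[of "{-1<..}" \<Gamma>] assms
    by (auto simp: ogden_P_alt elim!: eventually_mono)
  show "((\<lambda>x. (lam * x + mu * ((x + 1) - 1 / (x + 1))) / rho0) has_real_derivative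
          (lam + mu * (1 + 1 / (\<Gamma> + 1)\<^sup>2)) / rho0) (at \<Gamma>)"
    \<comment> \<open>With \<open>inverse rho0\<close> as a constant factor, differentiation raises
      no side condition on \<open>rho0\<close>.\<close>
    unfolding divide_inverse[of _ rho0] using assms
    by (auto intro!: derivative_eq_intros simp: power2_eq_square)
qed

lemma deriv_ogden_P_has_derivative:
  assumes "\<Gamma> > -1"
  shows "(deriv (ogden_P lam mu rho0) has_real_derivative
           - 2 * mu / (\<Gamma> + 1) ^ 3 / rho0) (at \<Gamma>)"
proof (rule DERIV_cong_ev[THEN iffD1, OF refl _ refl])
  show "\<forall>\<^sub>F x in nhds \<Gamma>. (lam + mu * (1 + 1 / (x + 1)\<^sup>2)) / rho0 = deriv (ogden_P lam mu rho0) x"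
    using eventually_nhds_in_open[of "{-1<..}" \<Gamma>] assms
    by (auto simp: DERIV_imp_deriv[OF ogden_P_has_derivative] elim!: eventually_mono)
  \<comment> \<open>The left-hand side is what the quotient rule yields for 1 / (x + 1)^2.\<close>
  have "- (2 * (\<Gamma> + 1)) / ((\<Gamma> + 1)\<^sup>2 * (\<Gamma> + 1)\<^sup>2) = - 2 / (\<Gamma> + 1) ^ 3"
    using assms by (simp add: divide_simps eval_nat_numeral)
  then have "((\<lambda>x. 1 / (x + 1)\<^sup>2) has_real_derivative - 2 / (\<Gamma> + 1) ^ 3) (at \<Gamma>)"
    using assms by (auto intro!: derivative_eq_intros simp: power2_eq_square)
  from DERIV_cdivide[OF DERIV_add[OF DERIV_const DERIV_cmult[OF DERIV_add[OF DERIV_const this]]],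
      of lam mu 1 rho0]
  show "((\<lambda>x. (lam + mu * (1 + 1 / (x + 1)\<^sup>2)) / rho0) has_real_derivative
          - 2 * mu / (\<Gamma> + 1) ^ 3 / rho0) (at \<Gamma>)"
    by (simp add: mult.commute)
qed

text \<open>Multiplied by mu / rho0, this quantity is the gap between the two sides of the entropy
  condition at \<Gamma> = s - 1.\<close>

lemma ln_ge_half_diff_inverse:
  fixes s :: real
  assumes "0 < s" "s \<le> 1"
  shows "0 \<le> 1 / s - s + 2 * ln s"
proof -
  have "1 / 1 - 1 + 2 * ln 1 \<le> 1 / s - s + 2 * ln s"
  proof (rule DERIV_nonpos_imp_nonincreasing[OF \<open>s \<le> 1\<close>])
    fix x :: real assume "s \<le> x" "x \<le> 1"
    then have "x > 0" using assms by simp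
    \<comment> \<open>The termwise derivative -1/x^2 - 1 + 2/x is minus a perfect square.\<close>
    then have "((\<lambda>t. 1 / t - t + 2 * ln t) has_real_derivative - ((1 - 1 / x)\<^sup>2)) (at x)"
      by (auto intro!: derivative_eq_intros simp: power2_eq_square field_simps)
    then show "\<exists>y. ((\<lambda>t. 1 / t - t + 2 * ln t) has_real_derivative y) (at x) \<and> y \<le> 0"
      by (intro exI conjI) auto
  qed
  then show ?thesis by simp
qed

lemma ogden_P_integral:
  assumes "\<Gamma> > -1"
  shows "(LBINT w=ereal 0..ereal \<Gamma>. ogden_P lam mu rho0 w) =
           (lam * \<Gamma>\<^sup>2 / 2 + mu * (((\<Gamma> + 1)\<^sup>2 - 1) / 2 - ln (\<Gamma> + 1))) / rho0"
proof -
  \<comment> \<open>Termwise primitive of the split form; the -1 beside the square normalises F to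
    vanish at 0.\<close>
  define F where
    "F x = (lam * x\<^sup>2 / 2 + mu * (((x + 1)\<^sup>2 - 1) / 2 - ln (x + 1))) / rho0" for x
  have "(LBINT w=ereal 0..ereal \<Gamma>. ogden_P lam mu rho0 w) = F \<Gamma> - F 0"
  proof (rule interval_integral_FTC_finite)
    \<comment> \<open>The min/max interval covers both orientations of the integral; \<Gamma> > -1
      keeps it away from the singularity at -1.\<close>
    show "continuous_on {min 0 \<Gamma>..max 0 \<Gamma>} (ogden_P lam mu rho0)"
      using assms
      by (auto intro!: continuous_at_imp_continuous_on DERIV_isCont[OF ogden_P_has_derivative])
    fix x assume "min 0 \<Gamma> \<le> x" "x \<le> max 0 \<Gamma>"
    then have x: "x > -1" using assms by auto
    have "(F has_real_derivative ogden_P lam mu rho0 x) (at x)"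
      unfolding F_def ogden_P_alt[OF x] divide_inverse[of _ rho0]
      using x by (auto intro!: derivative_eq_intros)
    then show "(F has_vector_derivative ogden_P lam mu rho0 x) (at x within {min 0 \<Gamma>..max 0 \<Gamma>})"
      by (simp add: has_real_derivative_iff_has_vector_derivative has_vector_derivative_at_within)
  qed
  then show ?thesis by (simp add: F_def)
qed

text \<open>The linear part of the stress contributes lam * \<Gamma>^2 / rho0 to both sides and
  cancels, so only the mu-part decides the inequality.\<close>

lemma std_entropy_condition_ogden_P:
  assumes "mu \<ge> 0" "rho0 > 0" "-1 < \<Gamma>" "\<Gamma> \<le> 0"
  shows "std_entropy_condition (ogden_P lam mu rho0) \<Gamma>"
proof -
  define s where "s = \<Gamma> + 1"
  have s: "0 < s" "s \<le> 1" and \<Gamma>: "\<Gamma> = s - 1"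
    using assms by (auto simp: s_def)
  have "\<Gamma> * ogden_P lam mu rho0 \<Gamma> - 2 * (LBINT w=ereal 0..ereal \<Gamma>. ogden_P lam mu rho0 w)
          = mu * (1 / s - s + 2 * ln s) / rho0"
    unfolding ogden_P_integral[OF assms(3)] ogden_P_alt[OF assms(3)]
    using s assms(2) by (simp add: \<Gamma> field_simps power2_eq_square)
  also have "\<dots> \<ge> 0"
    using ln_ge_half_diff_inverse[OF s] assms by simp
  finally show ?thesis by (simp add: std_entropy_condition_def)
qed

theorem mainTheorem7:
  fixes lam mu rho0 :: real
  assumes "lam > 0" and "mu > 0" and "rho0 > 0"
  shows "(\<forall>\<Gamma>>-1. ogden_P lam mu rho0 differentiable at \<Gamma> \<and>
                  deriv (ogden_P lam mu rho0) \<Gamma> > 0) \<and>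
         (\<forall>\<Gamma>>-1. deriv (ogden_P lam mu rho0) differentiable at \<Gamma> \<and>
                  deriv (deriv (ogden_P lam mu rho0)) \<Gamma> < 0) \<and>
         (\<forall>\<Gamma>\<^sub>l\<in>{-1<..0}. std_entropy_condition (ogden_P lam mu rho0) \<Gamma>\<^sub>l)"
proof (intro conjI allI impI ballI)
  fix \<Gamma> :: real assume \<Gamma>: "\<Gamma> > -1"
  note D1 = ogden_P_has_derivative[OF \<Gamma>, of lam mu rho0]
  note D2 = deriv_ogden_P_has_derivative[OF \<Gamma>, of lam mu rho0]
  show "ogden_P lam mu rho0 differentiable at \<Gamma>"
    using D1 by (auto simp: real_differentiable_def)
  show "deriv (ogden_P lam mu rho0) differentiable at \<Gamma>"
    using D2 by (auto simp: real_differentiable_def)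
  \<comment> \<open>Strictness is taken from \<open>lam\<close>; the mu-term enters as a nonnegative
    summand.\<close>
  have "lam + mu * (1 + 1 / (\<Gamma> + 1)\<^sup>2) > 0"
    using assms by (intro add_pos_nonneg) auto
  then show "deriv (ogden_P lam mu rho0) \<Gamma> > 0"
    unfolding DERIV_imp_deriv[OF D1] using assms by simp
  show "deriv (deriv (ogden_P lam mu rho0)) \<Gamma> < 0"
    unfolding DERIV_imp_deriv[OF D2] using assms \<Gamma> by (simp add: divide_neg_pos)
next
  fix \<Gamma>\<^sub>l :: real assume "\<Gamma>\<^sub>l \<in> {-1<..0}"
  then show "std_entropy_condition (ogden_P lam mu rho0) \<Gamma>\<^sub>l"
    using assms by (intro std_entropy_condition_ogden_P) auto
qed

end
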